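(* Suppose $k\ge1$ is an integer and suppose $n_j$ is a positive odd integer exceeding $1$, for $1\le j\le k$. Then there exists a symmetric half-set $\left(2^k,\frac{(\prod_{j=1}^k n_j)-1}{2}\right)$-$2^{k-1}$-fold near-factorization of $\mathbb{Z}_{n_1}\times\cdots\times\mathbb{Z}_{n_k}$.
   Context: $\mathbb{Z}_n$ denotes the additive cyclic group of order $n$. For subsets $S,T$ of a finite abelian group $G$ (written additively) and a positive integer $\lambda$, $(S,T)$ is an $(s,t)$-$\lambda$-fold near-factorization of $G$ if $|S|=s$, $|T|=t$, every nonzero element of $G$ can be written as $x+y$ with $x\in S$, $y\in T$ in exactly $\lambda$ ways, and $x+y\neq0$ for all $x\in S$, $y\in T$. It is a half-set near-factorization if $t=(|G|-1)/2$. It is symmetric if $S=-S$ and $T=-T$. *)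

theory Defs
  imports Complex_Main "HOL-Algebra.Product_Groups"
begin

text \<open>
  The groups are written additively in the literature and multiplicatively here.
  Representations \<open>g = x + y\<close> with \<open>x \<in> S\<close>, \<open>y \<in> T\<close> are counted as pairs \<open>(x, y)\<close>.
\<close>

definition near_factorization ::
  "('a, 'b) monoid_scheme \<Rightarrow> nat \<Rightarrow> nat \<Rightarrow> nat \<Rightarrow> 'a set \<Rightarrow> 'a set \<Rightarrow> bool" where
  "near_factorization G s t l S T \<longleftrightarrow>
     comm_group G \<and> finite (carrier G) \<and> l > 0 \<and>
     S \<subseteq> carrier G \<and> T \<subseteq> carrier G \<and> card S = s \<and> card T = t \<and>
     (\<forall>g \<in> carrier G - {\<one>\<^bsub>G\<^esub>}. card {(x, y) \<in> S \<times> T. x \<otimes>\<^bsub>G\<^esub> y = g} = l) \<and>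
     (\<forall>x \<in> S. \<forall>y \<in> T. x \<otimes>\<^bsub>G\<^esub> y \<noteq> \<one>\<^bsub>G\<^esub>)"

definition half_set_near_factorization ::
  "('a, 'b) monoid_scheme \<Rightarrow> nat \<Rightarrow> nat \<Rightarrow> nat \<Rightarrow> 'a set \<Rightarrow> 'a set \<Rightarrow> bool" where
  "half_set_near_factorization G s t l S T \<longleftrightarrow>
     near_factorization G s t l S T \<and> real t = (real (order G) - 1) / 2"

definition symmetric_pair :: "('a, 'b) monoid_scheme \<Rightarrow> 'a set \<Rightarrow> 'a set \<Rightarrow> bool" where
  "symmetric_pair G S T \<longleftrightarrow> S = m_inv G ` S \<and> T = m_inv G ` T"

end

theory Submission
  imports Defs
begin

text \<open>
  It suffices to find signs \<open>h : G \<rightarrow> {1, -1}\<close> whose convolution with the indicator of \<open>S\<close> is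
  \<open>|S|\<close> times the point mass at the identity: then \<open>T = {h = -1}\<close> has indicator \<open>(1 - h) / 2\<close>,
  whose convolution with \<open>S\<close> is \<open>|S| / 2\<close> away from the identity and \<open>0\<close> there. This condition
  is stable under direct products. On the integers modulo \<open>n = 2 m + 1\<close>, take \<open>S = {m, m + 1}\<close>
  and the signs alternating along \<open>-m, ..., m\<close>, starting and ending with \<open>1\<close>; the two
  elements of \<open>g - S\<close> are cyclically adjacent, so their signs cancel unless they
  are \<open>m\<close> and \<open>-m\<close>, that is, unless \<open>g = 0\<close>.
\<close>

lemma half_set_near_factorization_of_signs:
  fixes G (structure) and h :: "'a \<Rightarrow> int"
  assumes G: "comm_group G" and fin: "finite (carrier G)"
    and S: "S \<subseteq> carrier G" "card S = 2 * l" and l: "l > 0"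
    and h: "\<And>x. x \<in> carrier G \<Longrightarrow> h x \<in> {1, -1}"
    and conv: "\<And>g. g \<in> carrier G \<Longrightarrow>
      (\<Sum>s\<in>S. h (inv\<^bsub>G\<^esub> s \<otimes>\<^bsub>G\<^esub> g)) = (if g = \<one>\<^bsub>G\<^esub> then 2 * int l else 0)"
  shows "half_set_near_factorization G (2 * l) ((order G - 1) div 2) l S {x \<in> carrier G. h x = -1}"
proof -
  interpret comm_group G by fact
  define T where "T = {x \<in> carrier G. h x = -1}"
  have finS: "finite S" using S fin finite_subset by blast
  have finT: "finite T" unfolding T_def using fin by simp
  have h_ind: "h x = 1 - 2 * (if h x = -1 then 1 else 0)" if "x \<in> carrier G" for x
    using h[OF that] by auto
  \<comment> \<open>Since \<open>x\<close> determines \<open>y = inv x \<otimes> g\<close>,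
    representations of \<open>g\<close> correspond to the \<open>s\<close> in \<open>S\<close> with
    \<open>h (inv s \<otimes> g) = -1\<close>. Substituting \<open>h_ind\<close> in the convolution
    counts these. The identity is doubled to stay within the integers.\<close>
  have count: "2 * int (card {(x, y) \<in> S \<times> T. x \<otimes> y = g}) = (if g = \<one> then 0 else 2 * int l)"
    if g: "g \<in> carrier G" for g
  proof -
    have "bij_betw fst {(x, y) \<in> S \<times> T. x \<otimes> y = g} {s \<in> S. h (inv s \<otimes> g) = -1}"
    proof (rule bij_betw_byWitness[where f' = "\<lambda>s. (s, inv s \<otimes> g)"])
      show "\<forall>a\<in>{(x, y) \<in> S \<times> T. x \<otimes> y = g}. (fst a, inv fst a \<otimes> g) = a"
        using S(1) by (auto simp: T_def subset_iff m_assoc[symmetric])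
      show "fst ` {(x, y) \<in> S \<times> T. x \<otimes> y = g} \<subseteq> {s \<in> S. h (inv s \<otimes> g) = -1}"
        using S(1) by (auto simp: T_def subset_iff m_assoc[symmetric])
      show "(\<lambda>s. (s, inv s \<otimes> g)) ` {s \<in> S. h (inv s \<otimes> g) = -1} \<subseteq> {(x, y) \<in> S \<times> T. x \<otimes> y = g}"
        using S(1) g by (auto simp: T_def subset_iff m_assoc[symmetric])
    qed simp
    then have "card {(x, y) \<in> S \<times> T. x \<otimes> y = g} = card {s \<in> S. h (inv s \<otimes> g) = -1}"
      by (rule bij_betw_same_card)
    moreover have "(\<Sum>s\<in>S. h (inv s \<otimes> g))
        = (\<Sum>s\<in>S. 1 - 2 * (if h (inv s \<otimes> g) = -1 then 1 else 0))"
      by (rule sum.cong[OF refl], rule h_ind) (use S(1) g in auto)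
    moreover have "\<dots> = 2 * int l - 2 * int (card {s \<in> S. h (inv s \<otimes> g) = -1})"
      using finS S(2) by (simp add: sum_subtractf sum_distrib_left[symmetric] sum.If_cases Int_def)
    ultimately show ?thesis
      using conv[OF g] by auto
  qed
  have rep: "card {(x, y) \<in> S \<times> T. x \<otimes> y = g} = l" if "g \<in> carrier G - {\<one>}" for g
    using count[of g] that by auto
  have "{(x, y) \<in> S \<times> T. x \<otimes> y = \<one>} = {}"
  proof -
    \<comment> \<open>Finiteness is needed because \<open>card\<close> is also 0 on infinite
      sets.\<close>
    have "finite {(x, y) \<in> S \<times> T. x \<otimes> y = \<one>}"
      by (rule finite_subset[of _ "S \<times> T"]) (use finS finT in auto)
    with count[of \<one>] show ?thesis by simp
  qed
  then have nz: "\<forall>x\<in>S. \<forall>y\<in>T. x \<otimes> y \<noteq> \<one>" by auto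
  have translate: "(\<Sum>g\<in>carrier G. h (inv s \<otimes> g)) = (\<Sum>g\<in>carrier G. h g)" if "s \<in> S" for s
    by (rule sum.reindex_bij_witness[where i = "\<lambda>g. s \<otimes> g" and j = "\<lambda>g. inv s \<otimes> g"])
       (use S(1) that in \<open>auto simp: subset_iff m_assoc[symmetric]\<close>)
  \<comment> \<open>Summing the convolution over the group in two orders gives |S| times the sum of
    \<open>h\<close> on one side and |S| on the other. So \<open>h\<close> sums to 1, which forces
    the half-set size of \<open>T\<close>.\<close>
  have "2 * int l * (\<Sum>g\<in>carrier G. h g) = (\<Sum>s\<in>S. \<Sum>g\<in>carrier G. h (inv s \<otimes> g))"
    using S(2) by (simp add: translate)
  also have "\<dots> = (\<Sum>g\<in>carrier G. \<Sum>s\<in>S. h (inv s \<otimes> g))"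
    by (rule sum.swap)
  also have "\<dots> = (\<Sum>g\<in>carrier G. if g = \<one> then 2 * int l else 0)"
    by (rule sum.cong) (simp_all add: conv)
  also have "\<dots> = 2 * int l"
    using fin by (simp add: sum.delta)
  finally have "(\<Sum>g\<in>carrier G. h g) = 1"
    using l by simp
  also have "(\<Sum>g\<in>carrier G. h g) = (\<Sum>g\<in>carrier G. 1 - 2 * (if h g = -1 then 1 else 0))"
    by (rule sum.cong[OF refl], rule h_ind)
  also have "\<dots> = int (order G) - 2 * int (card T)"
    using fin
    by (simp add: sum_subtractf sum_distrib_left[symmetric] sum.If_cases Int_def order_def T_def)
  finally have "order G = 2 * card T + 1" by linarith
  then show ?thesis
    using rep nz fin S l G
    unfolding half_set_near_factorization_def near_factorization_def T_def[symmetric]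
    by (auto simp: T_def)
qed

text \<open>With n = 2 m + 1, adding m carries -m, ..., m to 0, ..., n - 1, so that the alternating
  signs become parity of the reduced residue.\<close>

definition alt_sign :: "nat \<Rightarrow> int \<Rightarrow> int" where
  "alt_sign n x = (if even ((x + int n div 2) mod int n) then 1 else -1)"

definition middle :: "nat \<Rightarrow> int set" where
  "middle n = {int n div 2, int n div 2 + 1}"

text \<open>The shift in \<open>alt_sign\<close> turns the terms for m and m + 1 into the parities
  of \<open>g\<close> and of \<open>g - 1\<close>. These are opposite except at
  \<open>g = 0\<close>, where \<open>g - 1\<close> wraps around to \<open>n - 1\<close>, which is
  even because \<open>n\<close> is odd.\<close>

lemma alt_sign_convolution:
  assumes "odd n" "n > 1" "0 \<le> g" "g < int n"
  shows "(\<Sum>s\<in>middle n. alt_sign n (((-s) mod int n + g) mod int n)) = (if g = 0 then 2 else 0)"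
proof -
  have "alt_sign n ((- (int n div 2) mod int n + g) mod int n) = (if even g then 1 else -1)"
    using assms by (simp add: alt_sign_def mod_simps)
  moreover have "alt_sign n ((- (int n div 2 + 1) mod int n + g) mod int n)
      = (if g = 0 \<or> odd g then 1 else -1)"
  proof -
    have "alt_sign n ((- (int n div 2 + 1) mod int n + g) mod int n)
        = (if even ((g - 1) mod int n) then 1 else -1)"
      by (simp add: alt_sign_def mod_simps)
    moreover have "(g - 1) mod int n = (if g = 0 then int n - 1 else g - 1)"
      using assms by (auto simp: zmod_minus1)
    ultimately show ?thesis using assms(1) by auto
  qed
  ultimately show ?thesis by (simp add: middle_def)
qed

text \<open>Negation reflects the shifted residue \<open>r\<close> to \<open>n - 1 - r\<close>, and
  \<open>n - 1\<close> is even, so the parity survives.\<close>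

lemma alt_sign_minus:
  assumes "odd n"
  shows "alt_sign n ((-x) mod int n) = alt_sign n x"
proof -
  define r where "r = (x + int n div 2) mod int n"
  have n: "int n > 0" using assms by (cases n) auto
  have m: "int n = 2 * (int n div 2) + 1" using assms by presburger
  have r: "0 \<le> r" "r < int n" using n by (simp_all add: r_def)
  have "((-x) mod int n + int n div 2) mod int n = (int n - 1 - (x + int n div 2)) mod int n"
  proof -
    have "- x + int n div 2 = int n - 1 - (x + int n div 2)" using m by linarith
    moreover have "((-x) mod int n + int n div 2) mod int n = (- x + int n div 2) mod int n"
      by (rule mod_add_left_eq)
    ultimately show ?thesis by metis
  qed
  also have "\<dots> = (int n - 1 - r) mod int n"
    by (simp add: r_def mod_simps)
  also have "\<dots> = int n - 1 - r" using r by simp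
  finally show ?thesis
    using assms by (simp add: alt_sign_def r_def[symmetric])
qed

lemma minus_middle:
  assumes "odd n" "n > 1" "s \<in> middle n"
  shows "(-s) mod int n \<in> middle n"
proof -
  have m: "int n = 2 * (int n div 2) + 1" using assms(1) by presburger
  have "(-s) mod int n = (int n - s) mod int n" by simp
  also have "\<dots> = int n - s" using assms m by (intro mod_pos_pos_trivial) (auto simp: middle_def)
  finally show ?thesis using assms(3) m by (auto simp: middle_def)
qed

text \<open>Inversion is an involution, so closure under it already gives the reverse inclusion.
  This reduces symmetry to a closure check.\<close>

lemma image_inv_eq:
  assumes "group G" "A \<subseteq> carrier G" "\<And>x. x \<in> A \<Longrightarrow> inv\<^bsub>G\<^esub> x \<in> A"
  shows "A = m_inv G ` A"
  using assms by (force simp: group.inv_inv subset_iff image_iff)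

theorem theorem2p21:
  fixes k :: nat and n :: "nat \<Rightarrow> nat"
  assumes "k \<ge> 1"
    and "\<And>j. j \<in> {1..k} \<Longrightarrow> odd (n j) \<and> n j > 1"
  shows "\<exists>S T. half_set_near_factorization (product_group {1..k} (\<lambda>j. integer_mod_group (n j)))
                  (2 ^ k) (((\<Prod>j = 1..k. n j) - 1) div 2) (2 ^ (k - 1)) S T
             \<and> symmetric_pair (product_group {1..k} (\<lambda>j. integer_mod_group (n j))) S T"
proof -
  define I where "I = {1..k}"
  define Z where "Z j = integer_mod_group (n j)" for j
  define G where "G = product_group I Z"
  define S where "S = PiE I (\<lambda>j. middle (n j))"
  define h where "h x = (\<Prod>j\<in>I. alt_sign (n j) (x j))" for x
  define T where "T = {x \<in> carrier G. h x = -1}"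
  have n: "odd (n j)" "n j > 1" if "j \<in> I" for j using assms(2) that by (auto simp: I_def)
  have finI: "finite I" by (simp add: I_def)
  have carZ: "carrier (Z j) = {0..<int (n j)}" if "j \<in> I" for j
    using n[OF that] by (simp add: Z_def carrier_integer_mod_group)
  have grpZ: "group (Z j)" for j by (simp add: Z_def)
  have grpG: "group G" by (simp add: G_def grpZ)
  have commG: "comm_group G"
    by (rule group.group_comm_groupI[OF grpG]) (auto simp: G_def Z_def add.commute)
  have carG: "carrier G = PiE I (\<lambda>j. {0..<int (n j)})"
    by (auto simp: G_def carZ intro!: PiE_cong)
  have invG: "inv\<^bsub>G\<^esub> x = (\<lambda>j\<in>I. (- x j) mod int (n j))" if "x \<in> carrier G" for x
    unfolding G_def using that
    by (subst inv_product_group) (auto simp: G_def grpZ Z_def PiE_iff intro!: restrict_ext)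
  have S: "S \<subseteq> carrier G"
    unfolding S_def carG
  proof (rule PiE_mono)
    fix j assume "j \<in> I"
    then have "odd (n j)" "n j > 1" by (rule n)+
    then show "middle (n j) \<subseteq> {0..<int (n j)}" unfolding middle_def by auto presburger
  qed
  \<comment> \<open>As \<open>k \<ge> 1\<close>, a factor 2 splits off, giving |S| the form
    \<open>2 * l\<close> that the sign criterion expects, with
    \<open>l = 2 ^ (k - 1)\<close>.\<close>
  have pow: "(2::nat) ^ k = 2 * 2 ^ (k - 1)" using assms(1) by (cases k) auto
  have cardS: "card S = 2 * 2 ^ (k - 1)"
  proof -
    have "card (middle a) = 2" for a by (simp add: middle_def)
    then show ?thesis unfolding pow[symmetric] by (simp add: S_def card_PiE finI) (simp add: I_def)
  qed
  have ordG: "order G = (\<Prod>j = 1..k. n j)"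
    by (simp add: order_def carG card_PiE finI) (simp add: I_def)
  have conv: "(\<Sum>s\<in>S. h (inv\<^bsub>G\<^esub> s \<otimes>\<^bsub>G\<^esub> g)) = (if g = \<one>\<^bsub>G\<^esub> then 2 * int (2 ^ (k - 1)) else 0)"
    if g: "g \<in> carrier G" for g
  proof -
    have "(\<Sum>s\<in>S. h (inv\<^bsub>G\<^esub> s \<otimes>\<^bsub>G\<^esub> g))
        = (\<Sum>s\<in>S. \<Prod>j\<in>I. alt_sign (n j) (((- s j) mod int (n j) + g j) mod int (n j)))"
    proof (rule sum.cong[OF refl])
      fix s assume "s \<in> S"
      then have "s \<in> carrier G" using S by blast
      then show "h (inv\<^bsub>G\<^esub> s \<otimes>\<^bsub>G\<^esub> g)
          = (\<Prod>j\<in>I. alt_sign (n j) (((- s j) mod int (n j) + g j) mod int (n j)))"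
        unfolding h_def by (intro prod.cong) (auto simp: invG, simp add: G_def Z_def)
    qed
    \<comment> \<open>Distributivity: \<open>S\<close> is the full product of the sets
      \<open>middle (n j)\<close>, so the convolution factors into those of the coordinates.\<close>
    also have "\<dots> = (\<Prod>j\<in>I. \<Sum>s\<in>middle (n j). alt_sign (n j) (((- s) mod int (n j) + g j) mod int (n j)))"
      unfolding S_def by (rule prod_sum_PiE[symmetric]) (auto simp: finI middle_def)
    also have "\<dots> = (\<Prod>j\<in>I. if g j = 0 then 2 else 0)"
      using g by (intro prod.cong alt_sign_convolution) (auto simp: n[simplified] carG PiE_iff)
    also have "\<dots> = (if \<forall>j\<in>I. g j = 0 then 2 ^ k else 0)"
      by (auto simp: finI) (auto simp: I_def)
    \<comment> \<open>Elements of \<open>G\<close> are extensional: outside \<open>I\<close> both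
      \<open>g\<close> and the identity are \<open>undefined\<close>, so coordinates in
      \<open>I\<close> decide equality.\<close>
    also have "(\<forall>j\<in>I. g j = 0) \<longleftrightarrow> g = \<one>\<^bsub>G\<^esub>"
      using g by (auto simp: G_def Z_def fun_eq_iff PiE_iff extensional_def)
    finally show ?thesis using assms(1) by (cases k) auto
  qed
  have h: "h x \<in> {1, -1}" for x
    unfolding h_def using finI by (induction I rule: finite_induct) (auto simp: alt_sign_def)
  have "half_set_near_factorization G (2 * 2 ^ (k - 1)) ((order G - 1) div 2) (2 ^ (k - 1)) S T"
    unfolding T_def
    by (rule half_set_near_factorization_of_signs[OF commG _ S cardS _ h conv])
       (simp_all add: carG finI finite_PiE)
  moreover have "symmetric_pair G S T"
    unfolding symmetric_pair_def
  proof (intro conjI image_inv_eq[OF grpG])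
    show "inv\<^bsub>G\<^esub> x \<in> S" if "x \<in> S" for x
    proof -
      from that S have "x \<in> carrier G" by blast
      with that show ?thesis by (auto simp: S_def invG PiE_iff n[simplified] minus_middle)
    qed
    show "inv\<^bsub>G\<^esub> x \<in> T" if "x \<in> T" for x
    proof -
      have x: "x \<in> carrier G" "h x = -1" using that by (auto simp: T_def)
      have "h (inv\<^bsub>G\<^esub> x) = h x"
        unfolding h_def by (rule prod.cong) (auto simp: invG x n alt_sign_minus)
      with x grpG show ?thesis by (simp add: T_def group.inv_closed)
    qed
  qed (use S in \<open>auto simp: T_def\<close>)
  ultimately show ?thesis
    unfolding pow ordG[symmetric] G_def I_def Z_def by blast
qed

end
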